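(* Let $w\ge0$ be an integer. If $w$ is even, the map $\mathrm{LSh}^{(2)}_w\to W_w$, $P\mapsto P|\delta$, is well defined and bijective. If $w$ is odd, the map $\mathrm{LSh}^{(2)}_w\to\mathrm{Hom}_{\mathbb Q}(W_w,\mathbb Q)$ sending $P$ to the functional $Q\mapsto(P,Q)$ is an isomorphism of $\mathbb Q$-vector spaces. In both cases $\dim_{\mathbb Q}\mathrm{LSh}^{(2)}_w=\lfloor\frac{w+2}{3}\rfloor$.
   Context: $V_w$ is the $\mathbb Q$-space of homogeneous polynomials of degree $w$ in $X,Y$. $\mathrm{GL}_2(\mathbb Z)$ acts on the right by $(P|A)(X,Y)=P(aX+bY,cX+dY)$ for $A=\begin{pmatrix}a&b\\c&d\end{pmatrix}$, extended linearly to $\mathbb Q[\mathrm{GL}_2(\mathbb Z)]$. $\varepsilon=\begin{pmatrix}0&1\\1&0\end{pmatrix}$, $\gamma=\begin{pmatrix}0&-1\\1&-1\end{pmatrix}$, $\delta=\begin{pmatrix}1&0\\0&-1\end{pmatrix}$, $\varepsilon'=\delta\varepsilon\delta$, $\gamma'=\delta\gamma\delta$. $\mathrm{LSh}^{(2)}_w=\{P\in V_w: P(X,X+Y)+P(Y,X+Y)=-P(X,-Y),\ P(X,Y)=P(-Y,-X)\}$. $W_w=\{Q\in V_w: Q|(1-\varepsilon')=0,\ Q|(1+\gamma'+\gamma'^2)=0\}$. Pairing: $\langle X^aY^{w-a},X^bY^{w-b}\rangle=(-1)^{a+1}\binom{w}{b}^{-1}\delta_{a,w-b}$ ($0\le a,b\le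 w$, Kronecker delta), extended bilinearly to $V_w\times V_w$, and $(P,Q):=\langle P|\delta,Q\rangle$. *)

theory Defs
  imports "HOL-Analysis.Analysis" "HOL-Computational_Algebra.Polynomial"
begin

text \<open>
  The ring of rational polynomials in two variables is \<open>\<rat>[X][Y]\<close>: the inner variable is \<open>X\<close>,
  the outer one is \<open>Y\<close>.
\<close>

type_synonym bipoly = "rat poly poly"

definition X\<^sub>b :: bipoly where "X\<^sub>b = [:[:0, 1:]:]"

definition Y\<^sub>b :: bipoly where "Y\<^sub>b = [:0, 1:]"

definition bscale :: "rat \<Rightarrow> bipoly \<Rightarrow> bipoly" where
  "bscale c P = smult [:c:] P"

definition bcoeff :: "bipoly \<Rightarrow> nat \<Rightarrow> nat \<Rightarrow> rat" where
  "bcoeff P i j = coeff (coeff P j) i"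

text \<open>\<open>bsubst P U V\<close> is \<open>P(U, V)\<close>.\<close>

definition bsubst :: "bipoly \<Rightarrow> bipoly \<Rightarrow> bipoly \<Rightarrow> bipoly" where
  "bsubst P U V =
     (\<Sum>j\<le>degree P. \<Sum>i\<le>degree (coeff P j). bscale (bcoeff P i j) (U ^ i * V ^ j))"

definition hom_polys :: "nat \<Rightarrow> bipoly set" where
  "hom_polys w = {P. \<forall>i j. bcoeff P i j \<noteq> 0 \<longrightarrow> i + j = w}"

global_interpretation bipoly: vector_space bscale
  by unfold_locales (simp_all add: bscale_def smult_add_right mult.commute
        flip: smult_add_left one_pCons)

definition mat2 :: "int \<Rightarrow> int \<Rightarrow> int \<Rightarrow> int \<Rightarrow> int ^ 2 ^ 2" where
  "mat2 a b c d = vector [vector [a, b], vector [c, d]]"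

definition act :: "bipoly \<Rightarrow> int ^ 2 ^ 2 \<Rightarrow> bipoly" where
  "act P A = bsubst P (of_int (A $ 1 $ 1) * X\<^sub>b + of_int (A $ 1 $ 2) * Y\<^sub>b)
                      (of_int (A $ 2 $ 1) * X\<^sub>b + of_int (A $ 2 $ 2) * Y\<^sub>b)"

definition mat_eps :: "int ^ 2 ^ 2" where "mat_eps = mat2 0 1 1 0"

definition mat_gamma :: "int ^ 2 ^ 2" where "mat_gamma = mat2 0 (-1) 1 (-1)"

definition mat_delta :: "int ^ 2 ^ 2" where "mat_delta = mat2 1 0 0 (-1)"

definition mat_eps' :: "int ^ 2 ^ 2" where
  "mat_eps' = mat_delta ** mat_eps ** mat_delta"

definition mat_gamma' :: "int ^ 2 ^ 2" where
  "mat_gamma' = mat_delta ** mat_gamma ** mat_delta"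

definition LSh2 :: "nat \<Rightarrow> bipoly set" where
  "LSh2 w = {P \<in> hom_polys w.
     bsubst P X\<^sub>b (X\<^sub>b + Y\<^sub>b) + bsubst P Y\<^sub>b (X\<^sub>b + Y\<^sub>b) = - bsubst P X\<^sub>b (- Y\<^sub>b) \<and>
     P = bsubst P (- Y\<^sub>b) (- X\<^sub>b)}"

text \<open>
  The action of the group ring elements \<open>1 - \<epsilon>'\<close> and \<open>1 + \<gamma>' + \<gamma>'\<^sup>2\<close> is written out by linearity.
\<close>

definition W_space :: "nat \<Rightarrow> bipoly set" where
  "W_space w = {Q \<in> hom_polys w.
     Q - act Q mat_eps' = 0 \<and>
     Q + act Q mat_gamma' + act Q (mat_gamma' ** mat_gamma') = 0}"

text \<open>
  The bilinear extension to \<open>V\<^sub>w \<times> V\<^sub>w\<close> of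
  \<open>\<langle>X\<^sup>a Y\<^sup>w\<^sup>-\<^sup>a, X\<^sup>b Y\<^sup>w\<^sup>-\<^sup>b\<rangle> = (-1)\<^sup>a\<^sup>+\<^sup>1 (w choose b)\<^sup>-\<^sup>1 \<delta>\<^sub>a\<^sub>,\<^sub>w\<^sub>-\<^sub>b\<close>; only meaningful on \<open>hom_polys w\<close>.
\<close>

definition mono_pairing :: "nat \<Rightarrow> nat \<Rightarrow> nat \<Rightarrow> rat" where
  "mono_pairing w a b =
     (-1) ^ (a + 1) * inverse (of_nat (w choose b)) * (if a = w - b then 1 else 0)"

definition pairing :: "nat \<Rightarrow> bipoly \<Rightarrow> bipoly \<Rightarrow> rat" where
  "pairing w P Q =
     (\<Sum>a\<le>w. \<Sum>b\<le>w. bcoeff P a (w - a) * bcoeff Q b (w - b) * mono_pairing w a b)"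

definition twisted_pairing :: "nat \<Rightarrow> bipoly \<Rightarrow> bipoly \<Rightarrow> rat" where
  "twisted_pairing w P Q = pairing w (act P mat_delta) Q"

text \<open>
  The dual space \<open>Hom(U, \<rat>)\<close> of a subspace \<open>U\<close>. Functionals are made extensional
  (\<open>undefined\<close> outside \<open>U\<close>), so that equality of functions is equality on \<open>U\<close>.
\<close>

definition dual_space :: "bipoly set \<Rightarrow> (bipoly \<Rightarrow> rat) set" where
  "dual_space U = {f \<in> extensional U.
     (\<forall>P\<in>U. \<forall>Q\<in>U. f (P + Q) = f P + f Q) \<and>
     (\<forall>c. \<forall>P\<in>U. f (bscale c P) = c * f P)}"

definition iso_to_dual :: "(bipoly \<Rightarrow> bipoly \<Rightarrow> rat) \<Rightarrow> bipoly set \<Rightarrow> bipoly set \<Rightarrow> bool" where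
  "iso_to_dual \<Phi> L U \<longleftrightarrow>
     bij_betw \<Phi> L (dual_space U) \<and>
     (\<forall>P\<in>L. \<forall>P'\<in>L. \<Phi> (P + P') = (\<lambda>Q\<in>U. \<Phi> P Q + \<Phi> P' Q)) \<and>
     (\<forall>c. \<forall>P\<in>L. \<Phi> (bscale c P) = (\<lambda>Q\<in>U. c * \<Phi> P Q))"

lemma bcoeff_simps [simp]:
  "bcoeff 0 i j = 0"
  "bcoeff (P + Q) i j = bcoeff P i j + bcoeff Q i j"
  "bcoeff (bscale c P) i j = c * bcoeff P i j"
  by (simp_all add: bcoeff_def bscale_def)

lemma bsubst_hom:
  assumes "P \<in> hom_polys w"
  shows "bsubst P U V = (\<Sum>a\<le>w. bscale (bcoeff P a (w - a)) (U ^ a * V ^ (w - a)))"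
proof -
  let ?t = "\<lambda>i j. bscale (bcoeff P i j) (U ^ i * V ^ j)"
  have z: "bcoeff P i j = 0" if "i + j \<noteq> w" for i j
    using assms that by (auto simp: hom_polys_def)
  have dc: "degree (coeff P j) \<le> w" for j
    by (rule degree_le) (use z in \<open>auto simp: bcoeff_def\<close>)
  have dP: "degree P \<le> w"
    by (rule degree_le) (use z in \<open>auto simp: bcoeff_def poly_eq_iff\<close>)
  have inner: "(\<Sum>i\<le>degree (coeff P j). ?t i j) = (\<Sum>i\<le>w. ?t i j)" for j
    by (rule sum.mono_neutral_left)
       (use dc in \<open>auto simp: bcoeff_def coeff_eq_0\<close>)
  have "bsubst P U V = (\<Sum>j\<le>degree P. \<Sum>i\<le>w. ?t i j)"
    by (simp add: bsubst_def inner)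
  also have "\<dots> = (\<Sum>j\<le>w. \<Sum>i\<le>w. ?t i j)"
    by (rule sum.mono_neutral_left)
       (use dP in \<open>auto simp: bcoeff_def coeff_eq_0\<close>)
  also have "\<dots> = (\<Sum>i\<le>w. \<Sum>j\<le>w. ?t i j)"
    by (rule sum.swap)
  also have "\<dots> = (\<Sum>i\<le>w. ?t i (w - i))"
  proof (rule sum.cong [OF refl])
    fix i assume "i \<in> {..w}"
    then have "?t i j = (if j = w - i then ?t i (w - i) else 0)" for j
      using z [of i j] by auto
    then have "(\<Sum>j\<le>w. ?t i j) = (\<Sum>j\<le>w. if j = w - i then ?t i (w - i) else 0)"
      by (intro sum.cong) auto
    then show "(\<Sum>j\<le>w. ?t i j) = ?t i (w - i)" by simp
  qed
  finally show ?thesis .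
qed

lemma hom_polys_subspace: "bipoly.subspace (hom_polys w)"
  unfolding bipoly.subspace_def hom_polys_def by (auto) (metis add_0)+

lemma bsubst_add:
  "P \<in> hom_polys w \<Longrightarrow> Q \<in> hom_polys w \<Longrightarrow>
     bsubst (P + Q) U V = bsubst P U V + bsubst Q U V"
  using bipoly.subspace_add [OF hom_polys_subspace, of P w Q]
  by (simp add: bsubst_hom bipoly.scale_left_distrib sum.distrib)

lemma bsubst_scale:
  "P \<in> hom_polys w \<Longrightarrow> bsubst (bscale c P) U V = bscale c (bsubst P U V)"
  using bipoly.subspace_scale [OF hom_polys_subspace, of P w c]
  by (simp add: bsubst_hom bipoly.scale_sum_right)

lemma bsubst_zero: "bsubst 0 U V = 0"
  by (simp add: bsubst_def)

lemma LSh2_subspace: "bipoly.subspace (LSh2 w)"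
  unfolding bipoly.subspace_def
proof (intro conjI ballI allI)
  show "0 \<in> LSh2 w"
    using bipoly.subspace_0 [OF hom_polys_subspace] by (simp add: LSh2_def bsubst_zero)
next
  fix P Q assume "P \<in> LSh2 w" "Q \<in> LSh2 w"
  then show "P + Q \<in> LSh2 w"
    using bipoly.subspace_add [OF hom_polys_subspace]
    by (auto simp: LSh2_def bsubst_add algebra_simps)
next
  fix c P assume "P \<in> LSh2 w"
  then show "bscale c P \<in> LSh2 w"
    using bipoly.subspace_scale [OF hom_polys_subspace]
    by (auto simp: LSh2_def bsubst_scale simp flip: bipoly.scale_right_distrib)
qed

lemma W_space_subspace: "bipoly.subspace (W_space w)"
  unfolding bipoly.subspace_def
proof (intro conjI ballI allI)
  show "0 \<in> W_space w"
    using bipoly.subspace_0 [OF hom_polys_subspace] by (simp add: W_space_def act_def bsubst_zero)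
next
  fix P Q assume *: "P \<in> W_space w" "Q \<in> W_space w"
  then have "act (P + Q) A = act P A + act Q A" for A
    by (auto simp: W_space_def act_def intro: bsubst_add)
  moreover have "P + Q + (a + b) + (c + d) = (P + a + c) + (Q + b + d)" for a b c d
    by simp
  ultimately show "P + Q \<in> W_space w"
    using * bipoly.subspace_add [OF hom_polys_subspace] by (simp add: W_space_def)
next
  fix c P assume *: "P \<in> W_space w"
  then have "act (bscale c P) A = bscale c (act P A)" for A
    by (auto simp: W_space_def act_def intro: bsubst_scale)
  then show "bscale c P \<in> W_space w"
    using * bipoly.subspace_scale [OF hom_polys_subspace]
    by (simp add: W_space_def flip: bipoly.scale_right_distrib)
qed

end

theory Submission
  imports Defs
begin

text \<open>
  Put \<open>R = P|\<delta>\<close>. The relations defining \<open>LSh2\<close> say that \<open>R\<close> is fixed by the swap \<open>\<epsilon>\<close> and killed by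
  \<open>1 + \<gamma>' + \<gamma>'\<^sup>2\<close>; for \<open>W\<close> the swap is replaced by \<open>\<epsilon>' = -\<epsilon>\<close>, which acts in the same way when \<open>w\<close>
  is even.

  For the dimension, the kernel of \<open>P \<mapsto> P(1, 0)\<close> on \<open>LSh2 w\<close> is \<open>X Y (X - Y) LSh2 (w - 3)\<close>, and
  \<open>X\<^sup>w + (-Y)\<^sup>w - 2 (Y - X)\<^sup>w\<close> lies outside it when \<open>w > 0\<close>, so the dimension grows by one
  whenever \<open>w\<close> grows by three.

  For the duality, \<open>\<langle>(x X + y Y)\<^sup>w, Q\<rangle> = -Q(y, -x)\<close>, so the adjoint of \<open>|A\<close> is the action of the
  adjugate of \<open>A\<close>. Under this adjunction the projections of \<open>V\<^sub>w\<close> onto the two spaces correspond to each other,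
  and nondegeneracy of the pairing on \<open>V\<^sub>w\<close> descends to them.
\<close>

section \<open>Evaluation at rational points\<close>

text \<open>Identities between polynomials are proved by comparing values at rational points, where
  a substitution becomes composition of functions.\<close>

definition beval :: "bipoly \<Rightarrow> rat \<Rightarrow> rat \<Rightarrow> rat" where
  "beval P u v = poly (poly P [:v:]) u"

lemma beval_simps [simp]:
  "beval 0 u v = 0"
  "beval 1 u v = 1"
  "beval (P + Q) u v = beval P u v + beval Q u v"
  "beval (P - Q) u v = beval P u v - beval Q u v"
  "beval (- P) u v = - beval P u v"
  "beval (P * Q) u v = beval P u v * beval Q u v"
  "beval (P ^ n) u v = beval P u v ^ n"
  "beval (bscale c P) u v = c * beval P u v"
  "beval X\<^sub>b u v = u"
  "beval Y\<^sub>b u v = v"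
  by (simp_all add: beval_def bscale_def X\<^sub>b_def Y\<^sub>b_def)

lemma beval_sum [simp]: "beval (sum f A) u v = (\<Sum>a\<in>A. beval (f a) u v)"
  by (induction A rule: infinite_finite_induct) simp_all

lemma beval_of_int [simp]: "beval (of_int k) u v = of_int k"
  by (simp add: beval_def of_int_poly)

lemma beval_altdef:
  "beval P u v = (\<Sum>j\<le>degree P. \<Sum>i\<le>degree (coeff P j). bcoeff P i j * (u ^ i * v ^ j))"
proof -
  have "beval P u v = (\<Sum>j\<le>degree P. poly (coeff P j * [:v:] ^ j) u)"
    by (simp add: beval_def poly_altdef [of P] poly_sum)
  also have "\<dots> = (\<Sum>j\<le>degree P. poly (coeff P j) u * v ^ j)"
    by simp
  finally show ?thesis
    by (simp add: poly_altdef bcoeff_def sum_distrib_right mult.assoc)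
qed

lemma beval_bsubst [simp]: "beval (bsubst P U V) u v = beval P (beval U u v) (beval V u v)"
  by (simp add: bsubst_def beval_altdef [of P])

text \<open>For fixed \<open>v\<close>, \<open>poly P [:v:]\<close> is a polynomial in
  \<open>X\<close> with every rational as a root, hence 0. So a nonzero \<open>P\<close> would have
  the infinitely many roots \<open>[:v:]\<close>.\<close>

lemma beval_eq_0_imp:
  assumes "\<And>u v. beval P u v = 0"
  shows "P = 0"
proof (rule ccontr)
  assume "P \<noteq> 0"
  then have "finite {x. poly P x = 0}"
    by (rule poly_roots_finite)
  moreover have "range (\<lambda>v. [:v:]) \<subseteq> {x. poly P x = 0}"
    using assms by (auto simp: beval_def simp flip: poly_all_0_iff_0)
  moreover have "infinite (range (\<lambda>v::rat. [:v:]))"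
    by (simp add: finite_image_iff inj_def infinite_UNIV_char_0)
  ultimately show False
    using finite_subset by blast
qed

lemma beval_eqI:
  assumes "\<And>u v. beval P u v = beval Q u v"
  shows "P = Q"
  using beval_eq_0_imp [of "P - Q"] assms by simp

lemma beval_eq_iff: "P = Q \<longleftrightarrow> (\<forall>u v. beval P u v = beval Q u v)"
  using beval_eqI by blast

section \<open>Homogeneous polynomials\<close>

lemma beval_hom:
  assumes "P \<in> hom_polys w"
  shows "beval P u v = (\<Sum>a\<le>w. bcoeff P a (w - a) * (u ^ a * v ^ (w - a)))"
proof -
  have "beval P u v = beval (bsubst P X\<^sub>b Y\<^sub>b) u v"
    by simp
  then show ?thesis
    by (simp add: bsubst_hom [OF assms] del: beval_bsubst)
qed

lemma beval_hom_scale: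
  assumes "P \<in> hom_polys w"
  shows "beval P (t * u) (t * v) = t ^ w * beval P u v"
proof -
  have "(t * u) ^ a * (t * v) ^ (w - a) = t ^ w * (u ^ a * v ^ (w - a))" if "a \<le> w" for a
    using that by (simp add: power_mult_distrib flip: power_add [of t a "w - a"])
  then show ?thesis
    by (simp add: beval_hom [OF assms] sum_distrib_left mult.left_commute)
qed

lemma hom_polys_add: "P \<in> hom_polys w \<Longrightarrow> Q \<in> hom_polys w \<Longrightarrow> P + Q \<in> hom_polys w"
  and hom_polys_scale: "P \<in> hom_polys w \<Longrightarrow> bscale c P \<in> hom_polys w"
  and hom_polys_diff: "P \<in> hom_polys w \<Longrightarrow> Q \<in> hom_polys w \<Longrightarrow> P - Q \<in> hom_polys w"
  and hom_polys_sum: "(\<And>a. a \<in> A \<Longrightarrow> f a \<in> hom_polys w) \<Longrightarrow> sum f A \<in> hom_polys w"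
  using hom_polys_subspace
  by (auto intro: bipoly.subspace_add bipoly.subspace_scale bipoly.subspace_diff bipoly.subspace_sum)

lemma hom_polys_mult:
  assumes "P \<in> hom_polys m" "Q \<in> hom_polys n"
  shows "P * Q \<in> hom_polys (m + n)"
  unfolding hom_polys_def
proof (intro CollectI allI impI)
  fix i j
  assume "bcoeff (P * Q) i j \<noteq> 0"
  then have "(\<Sum>k\<le>j. \<Sum>l\<le>i. bcoeff P l k * bcoeff Q (i - l) (j - k)) \<noteq> 0"
    by (simp add: bcoeff_def coeff_mult coeff_sum)
  then obtain k l where "k \<le> j" "l \<le> i" "bcoeff P l k * bcoeff Q (i - l) (j - k) \<noteq> 0"
    by (meson atMost_iff sum.not_neutral_contains_not_neutral)
  then show "i + j = m + n"
    using assms by (fastforce simp: hom_polys_def)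
qed

lemma hom_polys_1: "1 \<in> hom_polys 0"
  by (auto simp: hom_polys_def bcoeff_def coeff_1 split: if_splits)

lemma hom_polys_power:
  assumes "P \<in> hom_polys 1"
  shows "P ^ n \<in> hom_polys n"
proof (induction n)
  case 0
  then show ?case by (simp add: hom_polys_1)
next
  case (Suc n)
  then show ?case using hom_polys_mult [OF assms Suc] by simp
qed

lemma X_hom: "X\<^sub>b \<in> hom_polys 1"
  and Y_hom: "Y\<^sub>b \<in> hom_polys 1"
  by (auto simp: hom_polys_def bcoeff_def X\<^sub>b_def Y\<^sub>b_def coeff_pCons split: nat.splits if_splits)

lemma hom_polys_bsubst:
  assumes "P \<in> hom_polys w" "U \<in> hom_polys 1" "V \<in> hom_polys 1"
  shows "bsubst P U V \<in> hom_polys w"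
  unfolding bsubst_hom [OF assms(1)]
proof (intro hom_polys_sum hom_polys_scale)
  fix a assume "a \<in> {..w}"
  then show "U ^ a * V ^ (w - a) \<in> hom_polys w"
    using hom_polys_mult [OF hom_polys_power [OF assms(2), of a] hom_polys_power [OF assms(3), of "w - a"]]
    by simp
qed

definition hpoly :: "nat \<Rightarrow> (nat \<Rightarrow> rat) \<Rightarrow> bipoly" where
  "hpoly w c = (\<Sum>a\<le>w. bscale (c a) (X\<^sub>b ^ a * Y\<^sub>b ^ (w - a)))"

lemma hpoly_hom: "hpoly w c \<in> hom_polys w"
  unfolding hpoly_def
proof (intro hom_polys_sum hom_polys_scale)
  fix a assume "a \<in> {..w}"
  then show "X\<^sub>b ^ a * Y\<^sub>b ^ (w - a) \<in> hom_polys w"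
    using hom_polys_mult [OF hom_polys_power [OF X_hom, of a] hom_polys_power [OF Y_hom, of "w - a"]]
    by simp
qed

lemma bcoeff_sum: "bcoeff (sum f A) i j = (\<Sum>a\<in>A. bcoeff (f a) i j)"
  by (induction A rule: infinite_finite_induct) simp_all

lemma monomial_eq: "X\<^sub>b ^ a * Y\<^sub>b ^ b = monom (monom 1 a) b"
proof -
  have "X\<^sub>b ^ a = [:monom 1 a:]"
    by (simp add: X\<^sub>b_def monom_altdef poly_const_pow)
  moreover have "Y\<^sub>b ^ b = monom 1 b"
    by (simp add: Y\<^sub>b_def monom_altdef)
  ultimately show ?thesis
    by (simp add: smult_monom)
qed

lemma bcoeff_monomial: "bcoeff (X\<^sub>b ^ a * Y\<^sub>b ^ b) i j = (if i = a \<and> j = b then 1 else 0)"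
  by (auto simp: monomial_eq bcoeff_def)

lemma bcoeff_hpoly [simp]: "a \<le> w \<Longrightarrow> bcoeff (hpoly w c) a (w - a) = c a"
proof -
  assume "a \<le> w"
  then have "bcoeff (hpoly w c) a (w - a) = (\<Sum>k\<le>w. if k = a then c a else 0)"
    unfolding hpoly_def bcoeff_sum by (intro sum.cong) (auto simp: bcoeff_monomial)
  then show ?thesis
    using \<open>a \<le> w\<close> by simp
qed

lemma beval_hpoly: "beval (hpoly w c) u v = (\<Sum>a\<le>w. c a * (u ^ a * v ^ (w - a)))"
  by (simp add: hpoly_def)

lemma hom_eq_hpoly: "P \<in> hom_polys w \<Longrightarrow> P = hpoly w (\<lambda>a. bcoeff P a (w - a))"
  by (intro beval_eqI) (simp add: beval_hom beval_hpoly)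

section \<open>Linear substitutions and the two spaces\<close>

text \<open>The substitution of \<open>act\<close> with rational entries, so that the matrices in
  \<open>proj\<close> can contain the sign \<open>s\<close> as a parameter.\<close>

definition linsub :: "bipoly \<Rightarrow> rat \<Rightarrow> rat \<Rightarrow> rat \<Rightarrow> rat \<Rightarrow> bipoly" where
  "linsub P a b c d = bsubst P (bscale a X\<^sub>b + bscale b Y\<^sub>b) (bscale c X\<^sub>b + bscale d Y\<^sub>b)"

lemma beval_linsub [simp]: "beval (linsub P a b c d) u v = beval P (a * u + b * v) (c * u + d * v)"
  by (simp add: linsub_def)

lemma linsub_hom: "P \<in> hom_polys w \<Longrightarrow> linsub P a b c d \<in> hom_polys w"
  unfolding linsub_def by (intro hom_polys_bsubst hom_polys_add hom_polys_scale X_hom Y_hom)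

lemma beval_act:
  "beval (act P (mat2 a b c d)) u v =
     beval P (of_int a * u + of_int b * v) (of_int c * u + of_int d * v)"
  by (simp add: act_def mat2_def)

lemma mat2_mult:
  "mat2 a b c d ** mat2 a' b' c' d' =
     mat2 (a * a' + b * c') (a * b' + b * d') (c * a' + d * c') (c * b' + d * d')"
  by (simp add: mat2_def matrix_matrix_mult_def vec_eq_iff forall_2 sum_2)

lemma beval_act_simps [simp]:
  "beval (act P mat_delta) u v = beval P u (- v)"
  "beval (act P mat_eps') u v = beval P (- v) (- u)"
  "beval (act P mat_gamma') u v = beval P v (- u - v)"
  "beval (act P (mat_gamma' ** mat_gamma')) u v = beval P (- u - v) u"
  by (simp_all add: mat_eps'_def mat_gamma'_def mat_delta_def mat_eps_def mat_gamma_def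
        mat2_mult beval_act)

lemma act_delta_hom: "P \<in> hom_polys w \<Longrightarrow> act P mat_delta \<in> hom_polys w"
proof -
  have "act P mat_delta = linsub P 1 0 0 (-1)"
    by (intro beval_eqI) simp
  then show "P \<in> hom_polys w \<Longrightarrow> ?thesis"
    by (simp add: linsub_hom)
qed

lemma act_delta_act_delta [simp]: "act (act P mat_delta) mat_delta = P"
  by (intro beval_eqI) simp

lemma mem_LSh2_iff:
  "P \<in> LSh2 w \<longleftrightarrow> P \<in> hom_polys w \<and>
     (\<forall>u v. beval P u (u + v) + beval P v (u + v) = - beval P u (- v)) \<and>
     (\<forall>u v. beval P u v = beval P (- v) (- u))"
  by (simp add: LSh2_def beval_eq_iff)

lemma mem_W_space_iff:
  "Q \<in> W_space w \<longleftrightarrow> Q \<in> hom_polys w \<and>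
     (\<forall>u v. beval Q u v = beval Q (- v) (- u)) \<and>
     (\<forall>u v. beval Q u v + beval Q v (- u - v) + beval Q (- u - v) u = 0)"
  by (simp add: W_space_def beval_eq_iff)

text \<open>For \<open>P = act R mat_delta\<close> the symmetry of \<open>P\<close> is that of
  \<open>R\<close> with \<open>v\<close> negated, and the three-term relation reads
  \<open>R(u, -u-v) + R(v, -u-v) = -R(u, v)\<close>. Symmetry turns the first term into
  \<open>R(-u-v, u)\<close>.\<close>

lemma act_delta_mem_LSh2_iff:
  "act R mat_delta \<in> LSh2 w \<longleftrightarrow> R \<in> hom_polys w \<and>
     (\<forall>u v. beval R u v = beval R v u) \<and>
     (\<forall>u v. beval R u v + beval R v (- u - v) + beval R (- u - v) u = 0)"
    (is "?L \<longleftrightarrow> ?H \<and> ?S \<and> ?N")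
proof -
  have H: "act R mat_delta \<in> hom_polys w \<longleftrightarrow> ?H"
    using act_delta_hom [of R w] act_delta_hom [of "act R mat_delta" w] by auto
  have S: "(\<forall>u v. beval R u (- v) = beval R (- v) u) \<longleftrightarrow> ?S"
    by (metis minus_minus)
  have N: "(\<forall>u v. beval R u (- u - v) + beval R v (- u - v) = - beval R u v) \<longleftrightarrow> ?N" if ?S
  proof -
    have "beval R u (- u - v) = beval R (- u - v) u" for u v
      using that by blast
    then show ?thesis
      by (simp add: eq_neg_iff_add_eq_0 add_ac)
  qed
  show ?thesis
    using H S N by (auto simp: mem_LSh2_iff)
qed

lemma bij_betw_act_delta:
  assumes "even w"
  shows "bij_betw (\<lambda>P. act P mat_delta) (LSh2 w) (W_space w)"
proof -
  have "beval R (- v) (- u) = beval R v u" if "R \<in> hom_polys w" for R u v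
    using beval_hom_scale [OF that, of "-1" v u] assms by simp
  then have W: "R \<in> W_space w \<longleftrightarrow> act R mat_delta \<in> LSh2 w" for R
    unfolding act_delta_mem_LSh2_iff mem_W_space_iff by auto
  show ?thesis
    by (rule bij_betw_byWitness [where f' = "\<lambda>P. act P mat_delta"]) (auto simp: W)
qed

section \<open>The dimension\<close>

text \<open>Up to sign, the Vandermonde product of \<open>0\<close>, \<open>X\<close>,
  \<open>Y\<close>.\<close>

definition vandermonde :: bipoly where
  "vandermonde = X\<^sub>b * Y\<^sub>b * (X\<^sub>b - Y\<^sub>b)"

lemma beval_vandermonde [simp]: "beval vandermonde u v = u * v * (u - v)"
  by (simp add: vandermonde_def)

lemma vandermonde_nonzero: "vandermonde \<noteq> 0"
proof
  assume "vandermonde = 0"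
  then show False
    using beval_vandermonde [of 2 1] by simp
qed

text \<open>\<open>vandermonde\<close> has the same value at \<open>(u, u+v)\<close>,
  \<open>(v, u+v)\<close> and \<open>(u, -v)\<close>, and is fixed by
  \<open>(u, v) -> (-v, -u)\<close>. It therefore factors out of both relations and, the ring being
  a domain, cancels.\<close>

lemma vandermonde_mult_LSh2_iff:
  assumes "S \<in> hom_polys n"
  shows "vandermonde * S \<in> LSh2 (n + 3) \<longleftrightarrow> S \<in> LSh2 n"
proof -
  let ?D = "vandermonde * S"
  have "X\<^sub>b * Y\<^sub>b * (X\<^sub>b - Y\<^sub>b) \<in> hom_polys (1 + 1 + 1)"
    by (intro hom_polys_mult hom_polys_diff X_hom Y_hom)
  then have hom: "?D \<in> hom_polys (n + 3)"
    using hom_polys_mult [OF _ assms, of vandermonde 3]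
    by (simp add: vandermonde_def add.commute numeral_3_eq_3)
  define E where "E = bsubst S X\<^sub>b (X\<^sub>b + Y\<^sub>b) + bsubst S Y\<^sub>b (X\<^sub>b + Y\<^sub>b) + bsubst S X\<^sub>b (- Y\<^sub>b)"
  define F where "F = S - bsubst S (- Y\<^sub>b) (- X\<^sub>b)"
  have E: "bsubst ?D X\<^sub>b (X\<^sub>b + Y\<^sub>b) + bsubst ?D Y\<^sub>b (X\<^sub>b + Y\<^sub>b) + bsubst ?D X\<^sub>b (- Y\<^sub>b)
      = bsubst vandermonde X\<^sub>b (X\<^sub>b + Y\<^sub>b) * E"
    by (intro beval_eqI) (simp add: E_def algebra_simps)
  have F: "?D - bsubst ?D (- Y\<^sub>b) (- X\<^sub>b) = vandermonde * F"
    by (intro beval_eqI) (simp add: F_def algebra_simps)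
  have "bsubst vandermonde X\<^sub>b (X\<^sub>b + Y\<^sub>b) \<noteq> 0"
  proof
    assume "bsubst vandermonde X\<^sub>b (X\<^sub>b + Y\<^sub>b) = 0"
    then have "beval (bsubst vandermonde X\<^sub>b (X\<^sub>b + Y\<^sub>b)) 1 1 = 0"
      by simp
    then show False by simp
  qed
  then have "?D \<in> LSh2 (n + 3) \<longleftrightarrow> E = 0 \<and> F = 0"
    using E F hom vandermonde_nonzero by (auto simp: LSh2_def eq_neg_iff_add_eq_0)
  also have "\<dots> \<longleftrightarrow> S \<in> LSh2 n"
    using assms by (simp add: LSh2_def E_def F_def eq_neg_iff_add_eq_0)
  finally show ?thesis .
qed

text \<open>An element of \<open>LSh2 w\<close> vanishing at \<open>(1, 0)\<close> also vanishes at \<open>(0, 1)\<close> and \<open>(1, 1)\<close> by the two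
  relations, so the product of the three linear forms divides it.\<close>

lemma LSh2_divide:
  assumes P: "P \<in> LSh2 w" and z: "beval P 1 0 = 0" and nz: "P \<noteq> 0"
  obtains S n where "w = n + 3" "S \<in> LSh2 n" "P = vandermonde * S"
proof -
  have hom: "P \<in> hom_polys w"
    and rel: "\<And>u v. beval P u (u + v) + beval P v (u + v) = - beval P u (- v)"
    and sym: "\<And>u v. beval P u v = beval P (- v) (- u)"
    using P by (auto simp: mem_LSh2_iff)
  have z01: "beval P 0 1 = 0"
    using sym [of 0 1] beval_hom_scale [OF hom, of "-1" 1 0] z by simp
  have z11: "beval P 1 1 = 0"
    using rel [of 1 0] z z01 by simp
  \<comment> \<open>Dehomogenize at \<open>Y = 1\<close>: the zeros at \<open>(0, 1)\<close> and
    \<open>(1, 1)\<close> become the roots 0 and 1 of \<open>p\<close>, and the zero at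
    \<open>(1, 0)\<close> lowers its degree below \<open>w\<close>.\<close>
  define p where "p = (\<Sum>a\<le>w. monom (bcoeff P a (w - a)) a)"
  have p: "poly p u = beval P u 1" for u
    by (simp add: p_def beval_hom [OF hom] poly_sum poly_monom)
  have Pp: "beval P u v = v ^ w * poly p (u / v)" if "v \<noteq> 0" for u v
    using beval_hom_scale [OF hom, of v "u / v" 1] that by (simp add: p)
  have P0: "beval P u 0 = 0" for u
    using beval_hom_scale [OF hom, of u 1 0] z by simp
  have "p \<noteq> 0"
  proof
    assume "p = 0"
    then have "beval P u v = 0" for u v
      using Pp [of v u] P0 [of u] by (cases "v = 0") auto
    then show False using nz beval_eq_0_imp by blast
  qed
  have "bcoeff P w 0 = 0"
  proof -
    have "beval P 1 0 = (\<Sum>a\<le>w. if a = w then bcoeff P w 0 else 0)"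
      unfolding beval_hom [OF hom] by (intro sum.cong) (auto simp: power_0_left)
    then show ?thesis using z by simp
  qed
  then have degp: "degree p < w"
  proof -
    have c: "coeff p k = (if k \<le> w then bcoeff P k (w - k) else 0)" for k
      by (simp add: p_def coeff_sum)
    have "coeff p k = 0" if "k \<ge> w" for k
      using that \<open>bcoeff P w 0 = 0\<close> by (auto simp: c)
    then show ?thesis
      using \<open>p \<noteq> 0\<close> by (meson leading_coeff_neq_0 not_le)
  qed
  have "[:0, 1:] dvd p"
    using z01 p [of 0] poly_eq_0_iff_dvd [of p 0] by simp
  then obtain q where q: "p = [:0, 1:] * q" ..
  have "poly q 1 = 0"
    using z11 p [of 1] by (simp add: q)
  then have "[:-1, 1:] dvd q"
    using poly_eq_0_iff_dvd [of q 1] by simp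
  then obtain s where s: "q = [:-1, 1:] * s" ..
  have "s \<noteq> 0"
    using \<open>p \<noteq> 0\<close> q s by auto
  then have "degree q = Suc (degree s)"
    unfolding s by (subst degree_mult_eq) auto
  moreover have "degree p = Suc (degree q)"
    using \<open>p \<noteq> 0\<close> unfolding q by (subst degree_mult_eq) auto
  ultimately have w: "degree s + 3 \<le> w"
    using degp by simp
  \<comment> \<open>This subtraction is not truncated: two linear factors were split off from
    \<open>p\<close>, whose degree is less than \<open>w\<close>, and the cofactor \<open>s\<close>
    is nonzero.\<close>
  define n where "n = w - 3"
  define S where "S = hpoly n (coeff s)"
  have wn: "w = n + 3" and sn: "degree s \<le> n"
    using w by (auto simp: n_def)
  have S: "beval S u v = v ^ n * poly s (u / v)" if "v \<noteq> 0" for u v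
  proof -
    have "poly s x = (\<Sum>a\<le>n. coeff s a * x ^ a)" for x
      unfolding poly_altdef by (rule sum.mono_neutral_left) (use sn in \<open>auto simp: coeff_eq_0\<close>)
    then show ?thesis
      using that by (auto simp: S_def beval_hpoly sum_distrib_left power_divide power_diff
          intro!: sum.cong)
  qed
  have "P = vandermonde * S"
  proof (rule beval_eqI)
    fix u v
    \<comment> \<open>On the line \<open>v = 0\<close> dehomogenization gives nothing, but there
      both sides vanish.\<close>
    show "beval P u v = beval (vandermonde * S) u v"
    proof (cases "v = 0")
      case False
      have "v ^ w = v * v * v * v ^ n"
        by (simp add: wn power_add power3_eq_cube)
      then have "beval P u v = v * v * v * v ^ n * ((u / v) * ((u / v - 1) * poly s (u / v)))"
        by (simp add: Pp [OF False] q s algebra_simps)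
      also have "\<dots> = u * v * (u - v) * (v ^ n * poly s (u / v))"
        using False by (simp add: field_simps)
      finally show ?thesis
        by (simp add: S [OF False])
    qed (simp add: P0)
  qed
  moreover have "S \<in> LSh2 n"
    using P vandermonde_mult_LSh2_iff [of S n] \<open>P = vandermonde * S\<close> by (simp add: wn S_def hpoly_hom)
  ultimately show thesis
    using wn that by blast
qed

text \<open>After \<open>Y\<close> is negated this is \<open>X^n + Y^n - 2 Z^n\<close> with
  \<open>Z = -X-Y\<close>. That is symmetric in \<open>X\<close> and \<open>Y\<close>, and its sum
  over the cyclic permutations of \<open>X, Y, Z\<close> is 0.\<close>

definition extra_elem :: "nat \<Rightarrow> bipoly" where
  "extra_elem n = X\<^sub>b ^ n + (- Y\<^sub>b) ^ n - bscale 2 ((Y\<^sub>b - X\<^sub>b) ^ n)"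

lemma extra_elem_LSh2: "extra_elem n \<in> LSh2 n"
proof -
  have "- Y\<^sub>b = bscale (-1) Y\<^sub>b"
    by (intro beval_eqI) simp
  then have "- Y\<^sub>b \<in> hom_polys 1"
    by (simp only: hom_polys_scale [OF Y_hom])
  then have "extra_elem n \<in> hom_polys n"
    unfolding extra_elem_def
    by (intro hom_polys_diff hom_polys_add hom_polys_scale hom_polys_power X_hom Y_hom)
  then show ?thesis
    by (simp add: mem_LSh2_iff extra_elem_def minus_diff_commute)
qed

text \<open>The value is \<open>1 - 2 (-1)^n\<close>, so -1 or 3. For \<open>n = 0\<close> the
  polynomial is \<open>1 + 1 - 2 = 0\<close>.\<close>

lemma beval_extra_elem: "n > 0 \<Longrightarrow> beval (extra_elem n) 1 0 \<noteq> 0"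
  by (cases "even n") (auto simp: extra_elem_def power_0_left)

section \<open>Bases and the recursion for the dimension\<close>

lemma linear_vandermonde_mult: "Vector_Spaces.linear bscale bscale (\<lambda>S. vandermonde * S)"
  by unfold_locales (auto simp: algebra_simps bscale_def)

text \<open>\<open>B\<close> is a basis of the kernel of the functional \<open>P -> P(1, 0)\<close>;
  one further element with nonzero value completes it.\<close>

lemma LSh2_extend_basis:
  assumes n: "n > 0"
    and B: "bipoly.independent B" "finite B" "B \<subseteq> LSh2 n" "\<And>P. P \<in> B \<Longrightarrow> beval P 1 0 = 0"
    and span: "{P \<in> LSh2 n. beval P 1 0 = 0} \<subseteq> bipoly.span B"
  shows "bipoly.dim (LSh2 n) = card B + 1"
proof -
  let ?e = "extra_elem n"
  have "bipoly.subspace {P. beval P 1 0 = 0}"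
    by (auto simp: bipoly.subspace_def)
  then have "bipoly.span B \<subseteq> {P. beval P 1 0 = 0}"
    using B by (intro bipoly.span_minimal) auto
  then have e: "?e \<notin> bipoly.span B"
    using beval_extra_elem [OF n] by blast
  have "bipoly.independent (insert ?e B)"
    using e B by (simp add: bipoly.independent_insert bipoly.span_base)
  moreover have "insert ?e B \<subseteq> LSh2 n"
    using B extra_elem_LSh2 by simp
  moreover have "LSh2 n \<subseteq> bipoly.span (insert ?e B)"
  proof
    fix P assume P: "P \<in> LSh2 n"
    define c where "c = beval P 1 0 / beval ?e 1 0"
    have "P - bscale c ?e \<in> LSh2 n"
      using P extra_elem_LSh2 LSh2_subspace
      by (intro bipoly.subspace_diff bipoly.subspace_scale)
    moreover have "beval (P - bscale c ?e) 1 0 = 0"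
      using beval_extra_elem [OF n] by (simp add: c_def)
    ultimately have "P - bscale c ?e \<in> bipoly.span B"
      using span by blast
    then show "P \<in> bipoly.span (insert ?e B)"
      by (auto simp: bipoly.span_insert)
  qed
  moreover have "card (insert ?e B) = card B + 1"
    using e B bipoly.span_base [of ?e B] by (subst card_insert_disjoint) auto
  ultimately show ?thesis
    using bipoly.dim_unique by metis
qed

text \<open>\<open>bipoly.dim\<close> counts a basis by \<open>card\<close>, which is informative
  only for finite sets. Finiteness comes from the \<open>w + 1\<close> monomials, whose span
  contains the space.\<close>

lemma LSh2_finite_basis:
  obtains B where "bipoly.independent B" "finite B" "B \<subseteq> LSh2 w" "LSh2 w \<subseteq> bipoly.span B"
    "card B = bipoly.dim (LSh2 w)"
proof -
  let ?M = "(\<lambda>a. X\<^sub>b ^ a * Y\<^sub>b ^ (w - a)) ` {..w}"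
  have "LSh2 w \<subseteq> bipoly.span ?M"
  proof
    fix P assume "P \<in> LSh2 w"
    then have "P = hpoly w (\<lambda>a. bcoeff P a (w - a))"
      by (simp add: LSh2_def hom_eq_hpoly)
    also have "\<dots> \<in> bipoly.span ?M"
      unfolding hpoly_def by (intro bipoly.span_sum bipoly.span_scale bipoly.span_base) auto
    finally show "P \<in> bipoly.span ?M" .
  qed
  moreover obtain B where B: "B \<subseteq> LSh2 w" "bipoly.independent B" "LSh2 w \<subseteq> bipoly.span B"
      "card B = bipoly.dim (LSh2 w)"
    using bipoly.basis_exists by blast
  ultimately have "finite B"
    using bipoly.independent_span_bound [of ?M B] by blast
  with B show thesis
    using that by blast
qed

lemma dim_LSh2_add_3: "bipoly.dim (LSh2 (n + 3)) = bipoly.dim (LSh2 n) + 1"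
proof -
  interpret D: Vector_Spaces.linear bscale bscale "\<lambda>S. vandermonde * S"
    by (rule linear_vandermonde_mult)
  obtain B where B: "bipoly.independent B" "finite B" "B \<subseteq> LSh2 n" "LSh2 n \<subseteq> bipoly.span B"
    "card B = bipoly.dim (LSh2 n)"
    by (rule LSh2_finite_basis)
  let ?B = "(\<lambda>S. vandermonde * S) ` B"
  have inj: "inj (\<lambda>S. vandermonde * S)"
    using vandermonde_nonzero by (auto simp: inj_def)
  have "bipoly.dim (LSh2 (n + 3)) = card ?B + 1"
  proof (rule LSh2_extend_basis)
    show "bipoly.independent ?B"
      using B(1) inj_on_subset [OF inj] by (intro D.independent_injective_image) auto
    show "?B \<subseteq> LSh2 (n + 3)"
      using B(3) vandermonde_mult_LSh2_iff by (auto simp: LSh2_def)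
    show "{P \<in> LSh2 (n + 3). beval P 1 0 = 0} \<subseteq> bipoly.span ?B"
    proof
      fix P assume P: "P \<in> {P \<in> LSh2 (n + 3). beval P 1 0 = 0}"
      show "P \<in> bipoly.span ?B"
      proof (cases "P = 0")
        case False
        then obtain S where "S \<in> LSh2 n" "P = vandermonde * S"
          using P LSh2_divide [of P "n + 3"] by (metis (mono_tags, lifting) add_right_cancel mem_Collect_eq)
        then show ?thesis
          using B(4) by (auto simp: D.span_image)
      qed (simp add: bipoly.span_zero)
    qed
  qed (use B in auto)
  also have "card ?B = card B"
    using inj by (intro card_image inj_on_subset [OF inj]) auto
  finally show ?thesis
    using B by simp
qed

text \<open>Induction in steps of three from the values 0, 1, 1 at
  \<open>w = 0, 1, 2\<close>.\<close>

lemma dim_LSh2: "bipoly.dim (LSh2 w) = (w + 2) div 3"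
proof (induction w rule: less_induct)
  case (less w)
  \<comment> \<open>A nonzero element of the kernel has a cubic factor, which forces
    \<open>w\<close> to be at least 3.\<close>
  have small: "P = 0" if w: "w < 3" and P: "P \<in> LSh2 w" "beval P 1 0 = 0" for P
  proof (rule ccontr)
    assume "P \<noteq> 0"
    then obtain n S where "w = n + 3" "S \<in> LSh2 n" "P = vandermonde * S"
      by (rule LSh2_divide [OF P])
    then show False
      using w by simp
  qed
  consider "w = 0" | "0 < w" "w < 3" | n where "w = n + 3"
    by (metis le_add_diff_inverse2 not_less neq0_conv)
  then show ?case
  proof cases
    case 1
    have "LSh2 w \<subseteq> {0}"
    proof
      fix P assume P: "P \<in> LSh2 w"
      \<comment> \<open>In degree 0 the polynomial is a constant \<open>c\<close>, and the
        three-term relation says \<open>c + c = -c\<close>.\<close>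
      then have "beval P u v = beval P 0 0" for u v
        using beval_hom_scale [of P 0 0 u v] 1 by (simp add: mem_LSh2_iff)
      then have "beval P 1 0 + beval P 1 0 = - beval P 1 0"
        using P by (metis mem_LSh2_iff)
      then show "P \<in> {0}"
        using small [of P] P 1 by simp
    qed
    then have "LSh2 w \<subseteq> bipoly.span {}"
      by simp
    then show ?thesis
      using 1 bipoly.dim_le_card [of "LSh2 w" "{}"] by simp
  next
    case 2
    \<comment> \<open>The kernel is 0, so the extra element alone is a basis.\<close>
    have "bipoly.dim (LSh2 w) = card ({} :: bipoly set) + 1"
    proof (rule LSh2_extend_basis)
      show "{P \<in> LSh2 w. beval P 1 0 = 0} \<subseteq> bipoly.span {}"
        unfolding bipoly.span_empty using small [OF 2(2)] by blast
    qed (use 2 in \<open>auto simp: bipoly.independent_empty\<close>)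
    then show ?thesis
      using 2 by simp
  next
    case 3
    then show ?thesis
      using less.IH [of n] by (simp add: dim_LSh2_add_3)
  qed
qed

section \<open>The pairing\<close>

lemma pairing_altdef:
  "pairing w P Q =
     (\<Sum>a\<le>w. bcoeff P a (w - a) * bcoeff Q (w - a) a * (-1) ^ (a + 1) / of_nat (w choose a))"
  unfolding pairing_def
proof (rule sum.cong [OF refl])
  fix a assume "a \<in> {..w}"
  then have a: "a \<le> w" by simp
  have "(\<Sum>b\<le>w. bcoeff P a (w - a) * bcoeff Q b (w - b) * mono_pairing w a b)
      = (\<Sum>b\<le>w. if b = w - a then
          bcoeff P a (w - a) * bcoeff Q (w - a) a * (-1) ^ (a + 1) / of_nat (w choose a) else 0)"
    using a by (intro sum.cong)
      (auto simp: mono_pairing_def divide_inverse binomial_symmetric [of a w])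
  then show "(\<Sum>b\<le>w. bcoeff P a (w - a) * bcoeff Q b (w - b) * mono_pairing w a b)
      = bcoeff P a (w - a) * bcoeff Q (w - a) a * (-1) ^ (a + 1) / of_nat (w choose a)"
    by simp
qed

lemma bcoeff_diff [simp]: "bcoeff (P - Q) i j = bcoeff P i j - bcoeff Q i j"
  by (simp add: bcoeff_def)

lemma pairing_add_left: "pairing w (P + P') Q = pairing w P Q + pairing w P' Q"
  and pairing_diff_left: "pairing w (P - P') Q = pairing w P Q - pairing w P' Q"
  and pairing_scale_left: "pairing w (bscale c P) Q = c * pairing w P Q"
  and pairing_add_right: "pairing w P (Q + Q') = pairing w P Q + pairing w P Q'"
  and pairing_diff_right: "pairing w P (Q - Q') = pairing w P Q - pairing w P Q'"
  and pairing_scale_right: "pairing w P (bscale c Q) = c * pairing w P Q"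
  by (simp_all add: pairing_def algebra_simps sum.distrib sum_subtractf sum_distrib_left)

lemma pairing_zero_left: "pairing w 0 Q = 0"
  by (simp add: pairing_def)

lemma pairing_sum_left: "pairing w (sum f A) Q = (\<Sum>a\<in>A. pairing w (f a) Q)"
  by (induction A rule: infinite_finite_induct) (simp_all add: pairing_zero_left pairing_add_left)

text \<open>\<open>(x X + y Y)^w\<close> written out in monomials; its binomial coefficients cancel
  the denominators of \<open>pairing\<close>.\<close>

definition linpow :: "nat \<Rightarrow> rat \<Rightarrow> rat \<Rightarrow> bipoly" where
  "linpow w x y = hpoly w (\<lambda>a. of_nat (w choose a) * x ^ a * y ^ (w - a))"

lemma beval_linpow [simp]: "beval (linpow w x y) u v = (x * u + y * v) ^ w"
  unfolding binomial_ring by (simp add: linpow_def beval_hpoly power_mult_distrib algebra_simps)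

lemma linpow_hom: "linpow w x y \<in> hom_polys w"
  by (simp add: linpow_def hpoly_hom)

text \<open>After this cancellation the sum is the expansion of \<open>Q\<close> with
  \<open>a\<close> replaced by \<open>w - a\<close>; the sign \<open>(-1)^(a+1)\<close> supplies the
  outer minus and the one in \<open>-x\<close>.\<close>

lemma pairing_linpow:
  assumes "Q \<in> hom_polys w"
  shows "pairing w (linpow w x y) Q = - beval Q y (- x)"
proof -
  have "beval Q y (- x) = (\<Sum>a\<le>w. bcoeff Q (w - a) a * (y ^ (w - a) * (- x) ^ a))"
    unfolding beval_hom [OF assms]
    by (rule sum.reindex_bij_witness [where i = "\<lambda>a. w - a" and j = "\<lambda>a. w - a"]) auto
  then show ?thesis
    by (auto simp: pairing_altdef linpow_def power_minus [of x] simp flip: sum_negf intro!: sum.cong)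
qed

text \<open>On powers of linear forms this is immediate from the evaluation formula for the pairing, and comparing coefficients
  in \<open>(x X + Y)\<^sup>w\<close> as a polynomial in \<open>x\<close> gives it for all monomials.\<close>

lemma pairing_linsub:
  assumes P: "P \<in> hom_polys w" and Q: "Q \<in> hom_polys w"
  shows "pairing w (linsub P a b c d) Q = pairing w P (linsub Q d (- b) (- c) a)"
proof -
  let ?m = "\<lambda>k. X\<^sub>b ^ k * Y\<^sub>b ^ (w - k)"
  let ?U = "bscale a X\<^sub>b + bscale b Y\<^sub>b" and ?V = "bscale c X\<^sub>b + bscale d Y\<^sub>b"
  \<comment> \<open>\<open>F k\<close> is the defect of the claim on the monomial
    \<open>X^k Y^(w-k)\<close>; by linearity in \<open>P\<close> it suffices that all these defects
    vanish.\<close>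
  define F where "F k = pairing w (?U ^ k * ?V ^ (w - k)) Q
    - pairing w (?m k) (linsub Q d (- b) (- c) a)" for k
  have F: "pairing w (linsub R a b c d) Q - pairing w R (linsub Q d (- b) (- c) a)
      = (\<Sum>k\<le>w. bcoeff R k (w - k) * F k)" if R: "R \<in> hom_polys w" for R
  proof -
    have "pairing w (linsub R a b c d) Q = (\<Sum>k\<le>w. bcoeff R k (w - k) * pairing w (?U ^ k * ?V ^ (w - k)) Q)"
      by (simp add: linsub_def bsubst_hom [OF R] pairing_sum_left pairing_scale_left)
    moreover have "pairing w R Z = (\<Sum>k\<le>w. bcoeff R k (w - k) * pairing w (?m k) Z)" for Z
      by (subst hom_eq_hpoly [OF R]) (simp add: hpoly_def pairing_sum_left pairing_scale_left)
    ultimately show ?thesis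
      by (simp add: F_def right_diff_distrib sum_subtractf)
  qed
  have pow: "(\<Sum>k\<le>w. (of_nat (w choose k) * F k) * x ^ k) = 0" for x
  proof -
    have "linsub (linpow w x 1) a b c d = linpow w (a * x + c) (b * x + d)"
      by (intro beval_eqI) (simp add: algebra_simps)
    \<comment> \<open>By the evaluation formula both pairings equal
      \<open>-Q(b x + d, -(a x + c))\<close>.\<close>
    then have "pairing w (linsub (linpow w x 1) a b c d) Q
        - pairing w (linpow w x 1) (linsub Q d (- b) (- c) a) = 0"
      using Q by (simp add: pairing_linpow linsub_hom algebra_simps)
    then show ?thesis
      unfolding F [OF linpow_hom] by (simp add: linpow_def algebra_simps)
  qed
  define p where "p = (\<Sum>k\<le>w. monom (of_nat (w choose k) * F k) k)"
  have "poly p x = 0" for x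
    using pow [of x] by (simp add: p_def poly_sum poly_monom)
  then have "p = 0"
    by (simp flip: poly_all_0_iff_0)
  \<comment> \<open>The binomial coefficient is nonzero in this range, so it can be divided out of
    the coefficient of \<open>p\<close>.\<close>
  have "F k = 0" if "k \<le> w" for k
  proof -
    have "coeff p k = of_nat (w choose k) * F k"
      using that by (simp add: p_def coeff_sum)
    then show ?thesis
      using that \<open>p = 0\<close> by (simp add: not_less)
  qed
  then show ?thesis
    using F [OF P] by simp
qed

text \<open>Up to the factor 6, \<open>proj s\<close> projects onto the part of the standard isotypic component, for the copy
  of \<open>S\<^sub>3\<close> generated by \<open>\<gamma>'\<close> and the (signed) swap, that is fixed by the signed swap.\<close>

definition proj :: "rat \<Rightarrow> bipoly \<Rightarrow> bipoly" where
  "proj s P = bscale 2 P - linsub P 0 1 (-1) (-1) - linsub P (-1) (-1) 1 0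
     + (bscale 2 (linsub P 0 s s 0) - linsub P (-s) (-s) 0 s - linsub P s 0 (-s) (-s))"

lemma proj_hom: "P \<in> hom_polys w \<Longrightarrow> proj s P \<in> hom_polys w"
  unfolding proj_def by (intro hom_polys_add hom_polys_diff hom_polys_scale linsub_hom)

lemma beval_proj:
  "beval (proj s P) u v = 2 * beval P u v - beval P v (- u - v) - beval P (- u - v) u
     + (2 * beval P (s * v) (s * u) - beval P (s * (- u - v)) (s * v) - beval P (s * u) (s * (- u - v)))"
  by (simp add: proj_def algebra_simps)

text \<open>With \<open>G\<close> the image of \<open>P\<close> under
  \<open>2 - \<gamma>' - \<gamma>'^2\<close>, \<open>proj s P\<close> is
  \<open>G(u, v) + G(s v, s u)\<close>. For a sign \<open>s\<close> this is invariant under the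
  signed swap, and both summands have cyclic sum 0 because the swap only reverses the cycle
  \<open>u, v, -u-v\<close>.\<close>

lemma proj_W_space: "Q \<in> hom_polys w \<Longrightarrow> proj (-1) Q \<in> W_space w"
  by (simp add: mem_W_space_iff proj_hom beval_proj minus_diff_commute)

lemma proj_LSh2: "R \<in> hom_polys w \<Longrightarrow> act (proj 1 R) mat_delta \<in> LSh2 w"
  by (simp add: act_delta_mem_LSh2_iff proj_hom beval_proj minus_diff_commute)

text \<open>Adjoints are given by adjugates. The two matrices of order 3 are adjugate to each other;
  the three reflections have trace 0, so their adjugates are their negatives, which turns
  \<open>s\<close> into \<open>-s\<close>.\<close>

lemma pairing_proj:
  assumes "P \<in> hom_polys w" "Q \<in> hom_polys w" "s * s = 1"
  shows "pairing w (proj s P) Q = pairing w P (proj (- s) Q)"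
  using assms
  by (simp add: proj_def pairing_add_left pairing_add_right pairing_diff_left pairing_diff_right
      pairing_scale_left pairing_scale_right pairing_linsub)

text \<open>The cyclic relation makes the first half of \<open>proj\<close> equal to
  \<open>3 Q\<close>, and invariance under the signed swap makes the second half equal to the
  first.\<close>

lemma proj_on_W_space:
  assumes "Q \<in> W_space w"
  shows "proj (-1) Q = bscale 6 Q"
proof (rule beval_eqI)
  fix u v
  have N: "beval Q (- u - v) u = - beval Q u v - beval Q v (- u - v)"
    and sym: "\<And>u v. beval Q u v = beval Q (- v) (- u)"
    using assms by (auto simp: mem_W_space_iff eq_diff_eq eq_neg_iff_add_eq_0 add_ac)
  have "beval Q (- v) (- u) = beval Q u v" "beval Q (u + v) (- v) = beval Q v (- u - v)"
    "beval Q (- u) (u + v) = beval Q (- u - v) u"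
    using sym [of u v] sym [of v "- u - v"] sym [of "- u - v" u] by (simp_all add: add.commute)
  then show "beval (proj (-1) Q) u v = beval (bscale 6 Q) u v"
    using N by (simp add: beval_proj add.commute [of v u])
qed

lemma proj_on_LSh2:
  assumes "act R mat_delta \<in> LSh2 w"
  shows "proj 1 R = bscale 6 R"
proof (rule beval_eqI)
  fix u v
  have N: "beval R (- u - v) u = - beval R u v - beval R v (- u - v)"
    and sym: "\<And>u v. beval R u v = beval R v u"
    using assms by (auto simp: act_delta_mem_LSh2_iff eq_diff_eq eq_neg_iff_add_eq_0 add_ac)
  have "beval R v u = beval R u v" "beval R (- u - v) v = beval R v (- u - v)"
    "beval R u (- u - v) = beval R (- u - v) u"
    using sym by blast+
  then show "beval (proj 1 R) u v = beval (bscale 6 R) u v"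
    using N by (simp add: beval_proj)
qed

text \<open>In the monomial basis the pairing is antidiagonal with nonzero entries, so pairing with
  \<open>X^(w-a) Y^a\<close> isolates the coefficient of \<open>X^a Y^(w-a)\<close>.\<close>

lemma pairing_nondegenerate:
  assumes R: "R \<in> hom_polys w" and 0: "\<And>Q. Q \<in> hom_polys w \<Longrightarrow> pairing w R Q = 0"
  shows "R = 0"
proof (rule beval_eq_0_imp)
  fix u v
  have "bcoeff R a (w - a) = 0" if a: "a \<le> w" for a
  proof -
    let ?Q = "hpoly w (\<lambda>k. if k = w - a then 1 else 0)"
    have "bcoeff ?Q (w - k) k = (if k = a then 1 else 0)" if "k \<le> w" for k
      using bcoeff_hpoly [of "w - k" w] a that by auto
    then have "pairing w R ?Q
        = (\<Sum>k\<le>w. if k = a then bcoeff R a (w - a) * (-1) ^ (a + 1) / of_nat (w choose a) else 0)"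
      unfolding pairing_altdef by (intro sum.cong) auto
    then show ?thesis
      using 0 [OF hpoly_hom] a by (simp add: not_less)
  qed
  then show "beval R u v = 0"
    by (simp add: beval_hom [OF R])
qed

lemma pairing_represents:
  assumes add: "\<And>P Q. g (P + Q) = g P + g Q" and scale: "\<And>c P. g (bscale c P) = c * g P"
  obtains R where "R \<in> hom_polys w" "\<And>Q. Q \<in> hom_polys w \<Longrightarrow> pairing w R Q = g Q"
proof
  \<comment> \<open>Each coefficient divides the required value on the dual monomial by the
    antidiagonal entry \<open>(-1)^(a+1) / (w choose a)\<close>, whose sign is its own
    inverse.\<close>
  let ?R = "hpoly w (\<lambda>a. (-1) ^ (a + 1) * of_nat (w choose a) * g (X\<^sub>b ^ (w - a) * Y\<^sub>b ^ a))"
  show "?R \<in> hom_polys w"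
    by (rule hpoly_hom)
  fix Q assume Q: "Q \<in> hom_polys w"
  have "g 0 = 0"
    using scale [of 0 0] by simp
  then have g_sum: "g (sum f A) = (\<Sum>a\<in>A. g (f a))" for f and A :: "nat set"
    by (induction A rule: infinite_finite_induct) (auto simp: add)
  have "g Q = (\<Sum>b\<le>w. bcoeff Q b (w - b) * g (X\<^sub>b ^ b * Y\<^sub>b ^ (w - b)))"
    by (subst hom_eq_hpoly [OF Q]) (simp add: hpoly_def g_sum scale)
  also have "\<dots> = (\<Sum>a\<le>w. bcoeff Q (w - a) a * g (X\<^sub>b ^ (w - a) * Y\<^sub>b ^ a))"
    by (rule sum.reindex_bij_witness [where i = "\<lambda>a. w - a" and j = "\<lambda>a. w - a"]) auto
  also have "\<dots> = pairing w ?R Q"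
    unfolding pairing_altdef
    by (intro sum.cong) (auto simp: field_simps simp flip: power_add mult_2)
  finally show "pairing w ?R Q = g Q" ..
qed

text \<open>Representing a functional by the pairing needs its values on monomials, which may lie
  outside \<open>U\<close>; a basis of \<open>U\<close> provides a linear extension to all
  polynomials.\<close>

lemma dual_space_extend:
  assumes f: "f \<in> dual_space U" and U: "bipoly.subspace U"
  obtains g where "\<And>P Q. g (P + Q) = g P + g Q" "\<And>c P. g (bscale c P) = c * g P"
    "\<And>P. P \<in> U \<Longrightarrow> g P = f P"
proof -
  have "vector_space ((*) :: rat \<Rightarrow> rat \<Rightarrow> rat)"
    by unfold_locales (simp_all add: algebra_simps)
  then have pair: "vector_space_pair bscale ((*) :: rat \<Rightarrow> rat \<Rightarrow> rat)"
    by (intro vector_space_pair.intro bipoly.vector_space_axioms)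
  obtain B where B: "B \<subseteq> U" "bipoly.independent B" "U \<subseteq> bipoly.span B" "card B = bipoly.dim U"
    by (rule bipoly.basis_exists)
  obtain g where lin: "Vector_Spaces.linear bscale (*) g" and g: "\<forall>x\<in>B. g x = f x"
    using vector_space_pair.linear_independent_extend [OF pair B(2), of f] by blast
  interpret g: Vector_Spaces.linear bscale "(*)" g
    by (rule lin)
  have fU: "f (P + Q) = f P + f Q" "f (bscale c P) = c * f P" if "P \<in> U" "Q \<in> U" for P Q c
    using f that by (auto simp: dual_space_def)
  \<comment> \<open>The set where \<open>g\<close> and \<open>f\<close> agree is cut down to
    \<open>U\<close>, since \<open>f\<close> is linear only there.\<close>
  have "bipoly.subspace {P \<in> U. g P = f P}"
    using U fU fU(2) [of 0 0 0]
    by (auto simp: bipoly.subspace_def g.add g.scale g.zero)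
  then have "bipoly.span B \<subseteq> {P \<in> U. g P = f P}"
    using B g by (intro bipoly.span_minimal) auto
  then show thesis
    using that [of g] B(3) g.add g.scale by blast
qed

section \<open>The isomorphism with the dual space\<close>

lemma act_delta_add:
  "act (P + P') mat_delta = act P mat_delta + act P' mat_delta"
  and act_delta_diff:
  "act (P - P') mat_delta = act P mat_delta - act P' mat_delta"
  and act_delta_scale:
  "act (bscale c P) mat_delta = bscale c (act P mat_delta)"
  by (intro beval_eqI; simp)+

lemma twisted_pairing_iso:
  "iso_to_dual (\<lambda>P. \<lambda>Q\<in>W_space w. twisted_pairing w P Q) (LSh2 w) (W_space w)"
proof -
  let ?\<Phi> = "\<lambda>P. \<lambda>Q\<in>W_space w. twisted_pairing w P Q"
  have W_hom: "Q \<in> hom_polys w" if "Q \<in> W_space w" for Q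
    using that by (simp add: W_space_def)
  have inj: "inj_on ?\<Phi> (LSh2 w)"
  proof (rule inj_onI)
    fix P P' assume P: "P \<in> LSh2 w" "P' \<in> LSh2 w" and eq: "?\<Phi> P = ?\<Phi> P'"
    define R where "R = act (P - P') mat_delta"
    have R: "act R mat_delta \<in> LSh2 w"
      using P bipoly.subspace_diff [OF LSh2_subspace] by (simp add: R_def)
    then have hom: "R \<in> hom_polys w"
      by (simp add: act_delta_mem_LSh2_iff)
    have 0: "pairing w R Q = 0" if "Q \<in> W_space w" for Q
      using fun_cong [OF eq, of Q] that
      by (simp add: R_def twisted_pairing_def act_delta_diff pairing_diff_left)
    \<comment> \<open>Six times this pairing is that of \<open>proj 1 R\<close> with
      \<open>Q\<close>, hence that of \<open>R\<close> with \<open>proj (-1) Q\<close>, which lies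
      in \<open>W_space w\<close>.\<close>
    have "pairing w R Q = 0" if Q: "Q \<in> hom_polys w" for Q
      using pairing_proj [OF hom Q, of 1] 0 [OF proj_W_space [OF Q]]
      by (simp add: proj_on_LSh2 [OF R] pairing_scale_left)
    then have "R = 0"
      by (rule pairing_nondegenerate [OF hom])
    then have "act R mat_delta = 0"
      by (intro beval_eqI) simp
    then show "P = P'"
      by (simp add: R_def)
  qed
  have into: "?\<Phi> P \<in> dual_space (W_space w)" for P
    using bipoly.subspace_add [OF W_space_subspace] bipoly.subspace_scale [OF W_space_subspace]
    by (auto simp: dual_space_def twisted_pairing_def pairing_add_right pairing_scale_right)
  have onto: "f \<in> ?\<Phi> ` LSh2 w" if f: "f \<in> dual_space (W_space w)" for f
  proof -
    obtain g where g: "\<And>P Q. g (P + Q) = g P + g Q" "\<And>c P. g (bscale c P) = c * g P"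
      and gf: "\<And>P. P \<in> W_space w \<Longrightarrow> g P = f P"
      using dual_space_extend [OF f W_space_subspace] by blast
    obtain R where R: "R \<in> hom_polys w" "\<And>Q. Q \<in> hom_polys w \<Longrightarrow> pairing w R Q = g Q"
      using pairing_represents [of g w] g by blast
    \<comment> \<open>The outer \<open>mat_delta\<close> undoes the twist in the pairing. Moving
      \<open>proj 1\<close> to the other side gives \<open>proj (-1) Q = 6 Q\<close> on
      \<open>W_space w\<close>, which the factor \<open>1 / 6\<close> compensates.\<close>
    define P where "P = act (bscale (1 / 6) (proj 1 R)) mat_delta"
    have "P \<in> LSh2 w"
      unfolding P_def act_delta_scale
      using R by (intro bipoly.subspace_scale [OF LSh2_subspace] proj_LSh2)
    moreover have "twisted_pairing w P Q = f Q" if Q: "Q \<in> W_space w" for Q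
      using pairing_proj [OF R(1) W_hom [OF Q], of 1] R(2) [OF W_hom [OF Q]] gf [OF Q]
      by (simp add: twisted_pairing_def P_def pairing_scale_left proj_on_W_space [OF Q]
          pairing_scale_right)
    then have "?\<Phi> P = f"
      using f by (auto simp: dual_space_def extensional_def fun_eq_iff)
    ultimately show ?thesis by blast
  qed
  have "bij_betw ?\<Phi> (LSh2 w) (dual_space (W_space w))"
    unfolding bij_betw_def using inj into onto by blast
  then show ?thesis
    by (auto simp: iso_to_dual_def twisted_pairing_def act_delta_add act_delta_scale
        pairing_add_left pairing_scale_left fun_eq_iff restrict_def)
qed

theorem theorem5p3:
  fixes w :: nat
  shows "(even w \<longrightarrow> bij_betw (\<lambda>P. act P mat_delta) (LSh2 w) (W_space w)) \<and>
         (odd w \<longrightarrow>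
            iso_to_dual (\<lambda>P. \<lambda>Q\<in>W_space w. twisted_pairing w P Q) (LSh2 w) (W_space w)) \<and>
         bipoly.dim (LSh2 w) = (w + 2) div 3"
  using bij_betw_act_delta twisted_pairing_iso dim_LSh2 by blast

end
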